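(* Let $\{a_N\}_{N=0}^\infty \subset \mathbb{Z}^+$ be an increasing sequence of positive integers. Let $\{k(N)\}_{N\ge 1}$ be a sequence of non-negative real numbers such that $\frac{k(N)\,\sigma_{a_N}}{\sqrt{a_N}} \to 0$ as $N\to\infty$ and $\sum_{N=1}^\infty \frac{1}{k(N)^2} < \infty$. Suppose $\mu_{a_N} \to \mu$. Then, for every $u \in L^2[0,1]$, almost surely $W_{a_N}X_{a_N}W_{a_N}^*(u) \rightarrow \mu V(u)$ in the norm of $L^2[0,1]$ as $N\to\infty$.
   Context: For each $N\ge 1$, $X_N=\frac1N(X^N_{i,j})_{i,j=1}^N$ is an $N\times N$ random lower triangular matrix: the entries $X^N_{i,j}$ with $1\le j\le i\le N$ are iid (scalar, possibly complex) random variables with finite mean $\mu_N$ and finite variance $\sigma_N^2=E|X^N_{i,j}-\mu_N|^2$ (with $\sigma_N\ge 0$), and $X^N_{i,j}=0$ for $j>i$. All the matrices $X_N$ are defined on a common probability space; nothing is assumed on the joint law for different $N$. $V$ is the Volterra operator on $L^2[0,1]$: $V(f)(x)=\int_0^x f(t)\,dt$. For $1\le i\le N$ let $e_i^N=\sqrt N\,\mathbf 1_{[(i-1)/N,\,i/N]}\in L^2[0,1]$. $W_N:\mathbb{C}^N\to L^2[0,1]$ is the isometry $W_N(c_1,\dots,c_N)=\sum_{i=1}^N c_ie_i^N$; its adjoint is $W_N^*(f)=(\langle f,e_1^N\rangle,\dots,\langle f,e_N^N\rangle)$. "Increasing" means strictly increasing. The convention $1/0=+\infty$ is used, so the summability condition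 forces $k(N)>0$ for all $N\ge1$. *)

theory Defs
  imports "HOL-Probability.Probability" "Jordan_Normal_Form.Matrix"
begin

text \<open>
  Elements of the complex Hilbert space of square integrable functions on the unit interval are
  represented by functions on the reals; only the restriction to the unit interval matters, and
  functions that agree almost everywhere there represent the same element.
\<close>

definition L2 :: "(real \<Rightarrow> complex) set" where
  "L2 = {f. f \<in> borel_measurable (lebesgue_on {0..1}) \<and>
            integrable (lebesgue_on {0..1}) (\<lambda>x. (cmod (f x))\<^sup>2)}"

definition L2_norm :: "(real \<Rightarrow> complex) \<Rightarrow> real" where
  "L2_norm f = sqrt (\<integral>x. (cmod (f x))\<^sup>2 \<partial>lebesgue_on {0..1})"

definition L2_inner :: "(real \<Rightarrow> complex) \<Rightarrow> (real \<Rightarrow> complex) \<Rightarrow> complex" where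
  "L2_inner f g = (\<integral>x. f x * cnj (g x) \<partial>lebesgue_on {0..1})"

text \<open>
  Membership in \<^const>\<open>L2\<close> is part of the notion of convergence, because the Bochner integral in
  \<^const>\<open>L2_norm\<close> is \<open>0\<close> for functions whose square is not integrable.
\<close>

definition L2_tendsto :: "(nat \<Rightarrow> real \<Rightarrow> complex) \<Rightarrow> (real \<Rightarrow> complex) \<Rightarrow> bool" where
  "L2_tendsto F f \<longleftrightarrow> (\<forall>n. F n \<in> L2) \<and> f \<in> L2 \<and>
     (\<lambda>n. L2_norm (\<lambda>x. F n x - f x)) \<longlonglongrightarrow> 0"

definition Volterra :: "(real \<Rightarrow> complex) \<Rightarrow> real \<Rightarrow> complex" where
  "Volterra f x = (LINT t:{0..x}|lebesgue. f t)"

definition step_fun :: "nat \<Rightarrow> nat \<Rightarrow> real \<Rightarrow> complex" where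
  "step_fun N i x = complex_of_real (sqrt (real N) * indicator {(real i - 1) / N .. real i / N} x)"

text \<open>
  Vector and matrix indices start at \<open>0\<close>, whereas the step functions and the random entries are
  numbered from \<open>1\<close>; hence the shifts by \<^const>\<open>Suc\<close> below.
\<close>

definition W :: "nat \<Rightarrow> complex Matrix.vec \<Rightarrow> real \<Rightarrow> complex" where
  "W N c x = (\<Sum>i<N. vec_index c i * step_fun N (Suc i) x)"

definition W_adj :: "nat \<Rightarrow> (real \<Rightarrow> complex) \<Rightarrow> complex Matrix.vec" where
  "W_adj N f = Matrix.vec N (\<lambda>i. L2_inner f (step_fun N (Suc i)))"

definition lower_tri_indices :: "nat \<Rightarrow> (nat \<times> nat) set" where
  "lower_tri_indices N = {(i, j). 1 \<le> j \<and> j \<le> i \<and> i \<le> N}"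

text \<open>The matrix \<open>1/N (X i j)\<close>, where \<open>X\<close> gives the entries for \<open>1 \<le> i, j \<le> N\<close>.\<close>

definition scaled_mat :: "nat \<Rightarrow> (nat \<Rightarrow> nat \<Rightarrow> complex) \<Rightarrow> complex Matrix.mat" where
  "scaled_mat N X = (1 / of_nat N) \<cdot>\<^sub>m Matrix.mat N N (\<lambda>(i, j). X (Suc i) (Suc j))"

end

theory Submission
  imports Defs
begin

text \<open>
  Write \<open>c\<^sub>j = \<langle>u, e\<^sub>j\<rangle>\<close>. Partial sums of the \<open>c\<^sub>j\<close> telescope to \<open>\<surd>N\<close> times the Volterra
  primitive at a grid point, so replacing every entry by its mean gives \<open>\<mu>\<^sub>N\<close> times a step function
  sampling \<open>Vu\<close> at the grid points; as \<open>Vu\<close> is Hoelder continuous of exponent \<open>1/2\<close>, this converges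
  uniformly. The squared norm of the centred remainder has, by independence and Bessel, expectation at
  most \<open>\<sigma>\<^sub>N\<^sup>2 \<parallel>u\<parallel>\<^sup>2 / N\<close>. Along \<open>a\<^sub>N\<close> this is \<open>O(1/k(N)\<^sup>2)\<close>, hence summable, so the remainders are
  almost surely summable by monotone convergence and tend to zero.
\<close>

section \<open>Tools from integration and probability\<close>

text \<open>Cauchy-Schwarz applied to the indicator of \<open>A\<close> and to
  \<open>indicator A x * cmod (f x)\<close>. An indicator equals its own square, so the extra factor
  can be inserted freely, and its squared integral is the measure of \<open>A\<close>.\<close>

lemma cmod_set_integral_square_le:
  fixes f :: "'a \<Rightarrow> complex"
  assumes f [measurable]: "f \<in> borel_measurable M" and f2: "integrable M (\<lambda>x. (cmod (f x))\<^sup>2)"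
    and A [measurable]: "A \<in> sets M" and fin: "emeasure M A < \<infinity>"
  shows "(cmod (\<integral>x. indicator A x *\<^sub>R f x \<partial>M))\<^sup>2 \<le> measure M A * (\<integral>x. indicator A x * (cmod (f x))\<^sup>2 \<partial>M)"
proof -
  have i2: "integrable M (\<lambda>x. indicator A x * (cmod (f x))\<^sup>2)"
    using integrable_mult_indicator[OF A f2] by simp
  have "(\<integral>\<^sup>+x. norm (indicator A x *\<^sub>R f x) \<partial>M)\<^sup>2
      = (\<integral>\<^sup>+x. indicator A x * ennreal (indicator A x * cmod (f x)) \<partial>M)\<^sup>2"
    by (intro arg_cong[where f="\<lambda>t. t\<^sup>2"] nn_integral_cong) (auto simp: indicator_def)
  also have "\<dots> \<le> (\<integral>\<^sup>+x. (indicator A x)\<^sup>2 \<partial>M) * (\<integral>\<^sup>+x. (ennreal (indicator A x * cmod (f x)))\<^sup>2 \<partial>M)"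
    by (intro Cauchy_Schwarz_nn_integral) auto
  also have "(\<integral>\<^sup>+x. (indicator A x)\<^sup>2 \<partial>M) = (\<integral>\<^sup>+x. indicator A x \<partial>M)"
    by (intro nn_integral_cong) (auto simp: indicator_def)
  also have "\<dots> = measure M A"
    using fin by (simp add: emeasure_eq_ennreal_measure)
  also have "(\<integral>\<^sup>+x. (ennreal (indicator A x * cmod (f x)))\<^sup>2 \<partial>M)
      = (\<integral>\<^sup>+x. ennreal (indicator A x * (cmod (f x))\<^sup>2) \<partial>M)"
    by (intro nn_integral_cong) (auto simp: indicator_def ennreal_power)
  also have "\<dots> = ennreal (\<integral>x. indicator A x * (cmod (f x))\<^sup>2 \<partial>M)"
    by (intro nn_integral_eq_integral i2) auto
  finally have *: "(\<integral>\<^sup>+x. norm (indicator A x *\<^sub>R f x) \<partial>M)\<^sup>2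
      \<le> ennreal (measure M A * (\<integral>x. indicator A x * (cmod (f x))\<^sup>2 \<partial>M))"
    by (simp add: ennreal_mult)
  have "ennreal ((cmod (\<integral>x. indicator A x *\<^sub>R f x \<partial>M))\<^sup>2) \<le> (\<integral>\<^sup>+x. norm (indicator A x *\<^sub>R f x) \<partial>M)\<^sup>2"
  \<comment> \<open>If the integrand were not integrable, its Bochner integral would be
    \<open>0\<close> by convention and the bound trivial.\<close>
  proof (cases "integrable M (\<lambda>x. indicator A x *\<^sub>R f x)")
    case True
    from power_mono[OF integral_norm_bound_ennreal[OF this], of 2]
    show ?thesis by (simp add: ennreal_power)
  qed (simp add: not_integrable_integral_eq)
  from order_trans[OF this *] show ?thesis
    by (subst (asm) ennreal_le_iff) (auto intro!: mult_nonneg_nonneg integral_nonneg_AE)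
qed

text \<open>The square expands into a double sum of terms \<open>X i * cnj (X j)\<close>. For
  \<open>i \<noteq> j\<close> independence factors the expectation into a product of means, which
  are zero; the diagonal leaves the second moments.\<close>

lemma (in prob_space) expectation_cmod_sum_square_indep:
  fixes X :: "'i \<Rightarrow> 'a \<Rightarrow> complex"
  assumes J: "finite J" and indep: "indep_vars (\<lambda>_. borel) X J"
    and int: "\<And>j. j \<in> J \<Longrightarrow> integrable M (X j)"
    and mean: "\<And>j. j \<in> J \<Longrightarrow> expectation (X j) = 0"
    and int2: "\<And>j. j \<in> J \<Longrightarrow> integrable M (\<lambda>\<omega>. (cmod (X j \<omega>))\<^sup>2)"
  shows "integrable M (\<lambda>\<omega>. (cmod (\<Sum>j\<in>J. c j * X j \<omega>))\<^sup>2)"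
    and "expectation (\<lambda>\<omega>. (cmod (\<Sum>j\<in>J. c j * X j \<omega>))\<^sup>2) =
      (\<Sum>j\<in>J. (cmod (c j))\<^sup>2 * expectation (\<lambda>\<omega>. (cmod (X j \<omega>))\<^sup>2))"
proof -
  have off: "integrable M (\<lambda>\<omega>. X i \<omega> * cnj (X j \<omega>)) \<and> expectation (\<lambda>\<omega>. X i \<omega> * cnj (X j \<omega>)) = 0"
    if ij: "i \<in> J" "j \<in> J" "i \<noteq> j" for i j
  proof -
    \<comment> \<open>Folding the conjugation into the family makes \<open>X i * cnj (X j)\<close> a
      product over the two-element index set, as the product rule for independent variables
      requires.\<close>
    define Y where "Y = (\<lambda>l \<omega>. (if l = j then cnj else id) (X l \<omega>))"
    have "indep_vars (\<lambda>_. borel) X {i, j}"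
      using indep by (rule indep_vars_subset) (use ij in auto)
    then have Y: "indep_vars (\<lambda>_. borel) Y {i, j}"
      unfolding Y_def
      by (rule indep_vars_compose2) (auto intro!: borel_measurable_continuous_onI continuous_intros)
    have Yint: "integrable M (Y l)" if "l \<in> {i, j}" for l
      using int ij that by (auto simp: Y_def)
    have eq: "(\<lambda>\<omega>. \<Prod>l\<in>{i, j}. Y l \<omega>) = (\<lambda>\<omega>. X i \<omega> * cnj (X j \<omega>))"
      using ij by (auto simp: Y_def)
    have "expectation (\<lambda>\<omega>. \<Prod>l\<in>{i, j}. Y l \<omega>) = (\<Prod>l\<in>{i, j}. expectation (Y l))"
      by (rule indep_vars_lebesgue_integral[OF _ Y Yint]) auto
    also have "\<dots> = 0"
      using ij mean by (auto simp: Y_def)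
    finally show ?thesis
      using indep_vars_integrable[OF _ Y Yint] unfolding eq by auto
  qed
  have diag: "X i \<omega> * cnj (X i \<omega>) = complex_of_real ((cmod (X i \<omega>))\<^sup>2)" for i \<omega>
    by (simp only: complex_norm_square)
  have int_prod: "integrable M (\<lambda>\<omega>. X i \<omega> * cnj (X j \<omega>))" if "i \<in> J" "j \<in> J" for i j
    using off[OF that] int2[OF that(1)] by (cases "i = j") (auto simp only: diag integrable_of_real)
  have expand: "complex_of_real ((cmod (\<Sum>j\<in>J. c j * X j \<omega>))\<^sup>2)
      = (\<Sum>i\<in>J. \<Sum>j\<in>J. c i * cnj (c j) * (X i \<omega> * cnj (X j \<omega>)))" for \<omega>
    unfolding complex_norm_square by (simp add: sum_product algebra_simps)
  \<comment> \<open>The expansion is an identity between complex numbers, so integrability and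
    expectation are computed there and then carried back to the reals.\<close>
  have intC: "integrable M (\<lambda>\<omega>. complex_of_real ((cmod (\<Sum>j\<in>J. c j * X j \<omega>))\<^sup>2))"
    unfolding expand by (intro Bochner_Integration.integrable_sum integrable_mult_right int_prod) auto
  then show "integrable M (\<lambda>\<omega>. (cmod (\<Sum>j\<in>J. c j * X j \<omega>))\<^sup>2)"
    by (simp only: complex_of_real_integrable_eq)
  have "complex_of_real (expectation (\<lambda>\<omega>. (cmod (\<Sum>j\<in>J. c j * X j \<omega>))\<^sup>2))
      = (\<Sum>i\<in>J. \<Sum>j\<in>J. c i * cnj (c j) * expectation (\<lambda>\<omega>. X i \<omega> * cnj (X j \<omega>)))"
  proof -
    have *: "integrable M (\<lambda>\<omega>. c i * cnj (c j) * (X i \<omega> * cnj (X j \<omega>)))" if "i \<in> J" "j \<in> J" for i j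
      using int_prod[OF that] by (rule integrable_mult_right)
    show ?thesis
      unfolding integral_complex_of_real[symmetric] expand
      by (simp add: Bochner_Integration.integral_sum Bochner_Integration.integrable_sum *
          del: integral_complex_of_real mult_eq_0_iff)
  qed
  also have "\<dots> = (\<Sum>i\<in>J. \<Sum>j\<in>J. if j = i then c i * cnj (c i) * expectation (\<lambda>\<omega>. X i \<omega> * cnj (X i \<omega>)) else 0)"
    by (intro sum.cong refl) (use off in auto)
  also have "\<dots> = (\<Sum>i\<in>J. c i * cnj (c i) * expectation (\<lambda>\<omega>. X i \<omega> * cnj (X i \<omega>)))"
    using J by simp
  also have "\<dots> = complex_of_real (\<Sum>j\<in>J. (cmod (c j))\<^sup>2 * expectation (\<lambda>\<omega>. (cmod (X j \<omega>))\<^sup>2))"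
    unfolding diag by (simp add: complex_norm_square[symmetric] del: of_real_power)
  finally show "expectation (\<lambda>\<omega>. (cmod (\<Sum>j\<in>J. c j * X j \<omega>))\<^sup>2) =
      (\<Sum>j\<in>J. (cmod (c j))\<^sup>2 * expectation (\<lambda>\<omega>. (cmod (X j \<omega>))\<^sup>2))"
    by (simp only: of_real_eq_iff)
qed

text \<open>Sum and integral of nonnegative terms may be exchanged, so the random series has finite
  expectation. It is therefore almost surely finite, and the terms of a convergent series tend to
  zero.\<close>

lemma AE_tendsto_0_if_suminf_expectation_finite:
  fixes R :: "nat \<Rightarrow> 'a \<Rightarrow> real"
  assumes int: "\<And>n. integrable M (R n)" and nonneg: "\<And>n x. 0 \<le> R n x"
    and fin: "(\<Sum>n. ennreal (integral\<^sup>L M (R n))) < \<infinity>"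
  shows "AE x in M. (\<lambda>n. R n x) \<longlonglongrightarrow> 0"
proof -
  have [measurable]: "R n \<in> borel_measurable M" for n using int by auto
  have "(\<integral>\<^sup>+x. (\<Sum>n. ennreal (R n x)) \<partial>M) = (\<Sum>n. \<integral>\<^sup>+x. ennreal (R n x) \<partial>M)"
    by (rule nn_integral_suminf) auto
  also have "\<dots> = (\<Sum>n. ennreal (integral\<^sup>L M (R n)))"
    by (simp add: nn_integral_eq_integral int nonneg)
  finally have "AE x in M. (\<Sum>n. ennreal (R n x)) \<noteq> \<infinity>"
    using fin by (intro nn_integral_PInf_AE) auto
  then show ?thesis
  proof eventually_elim
    case (elim x)
    then have "summable (\<lambda>n. R n x)"
      by (intro summable_suminf_not_top nonneg) auto
    then show ?case by (rule summable_LIMSEQ_zero)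
  qed
qed

section \<open>Lebesgue measure on the unit interval and the Volterra primitive\<close>

abbreviation "unit_leb \<equiv> lebesgue_on {0..1::real}"

lemma finite_measure_unit_leb: "finite_measure unit_leb"
  by (rule finite_measure_lebesgue_on) auto

lemma sets_unit_leb_I [intro]: "A \<in> sets borel \<Longrightarrow> A \<subseteq> {0..1} \<Longrightarrow> A \<in> sets unit_leb"
  by (subst sets_restrict_space_iff) auto

lemma Ioc_sets_unit_leb: "0 \<le> x \<Longrightarrow> y \<le> 1 \<Longrightarrow> {x<..y} \<in> sets unit_leb"
  by (intro sets_unit_leb_I) auto

lemma measure_unit_leb_Ioc: "0 \<le> x \<Longrightarrow> x \<le> y \<Longrightarrow> y \<le> 1 \<Longrightarrow> measure unit_leb {x<..y} = y - x"
  by (subst measure_restrict_space) auto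

lemma measure_unit_leb_Icc: "0 \<le> x \<Longrightarrow> x \<le> y \<Longrightarrow> y \<le> 1 \<Longrightarrow> measure unit_leb {x..y} = y - x"
  by (subst measure_restrict_space) auto

lemma L2_integrableD:
  assumes "u \<in> L2"
  shows "u \<in> borel_measurable unit_leb" "integrable unit_leb (\<lambda>x. (cmod (u x))\<^sup>2)" "integrable unit_leb u"
proof -
  interpret finite_measure unit_leb by (rule finite_measure_unit_leb)
  show m: "u \<in> borel_measurable unit_leb" and i: "integrable unit_leb (\<lambda>x. (cmod (u x))\<^sup>2)"
    using assms by (auto simp: L2_def)
  have "integrable unit_leb (\<lambda>x. cmod (u x))"
    by (rule square_integrable_imp_integrable) (use m i in \<open>auto simp: less_top[symmetric]\<close>)
  then show "integrable unit_leb u"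
    using m by (simp add: integrable_norm_iff)
qed

lemma integral_unit_leb_nonneg: "0 \<le> (\<integral>x. (cmod (u x))\<^sup>2 \<partial>unit_leb)"
  by (simp add: integral_nonneg_AE)

text \<open>For \<open>x \<le> 1\<close> the set \<open>{0..x}\<close> lies in the unit interval, so
  the primitive can be computed in the same finite measure space as the norm and the inner
  product.\<close>

lemma Volterra_eq_unit_leb:
  assumes "x \<le> 1"
  shows "Volterra u x = (\<integral>t. indicator {0..x} t *\<^sub>R u t \<partial>unit_leb)"
proof -
  have "(\<integral>t. indicator {0..x} t *\<^sub>R u t \<partial>unit_leb)
      = (\<integral>t. indicator {0..1} t *\<^sub>R indicator {0..x} t *\<^sub>R u t \<partial>lebesgue)"
    by (subst integral_restrict_space) auto
  also have "\<dots> = (\<integral>t. indicator {0..x} t *\<^sub>R u t \<partial>lebesgue)"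
    by (intro Bochner_Integration.integral_cong) (use assms in \<open>auto simp: indicator_def\<close>)
  finally show ?thesis by (simp add: Volterra_def set_lebesgue_integral_def)
qed

lemma Volterra_diff_eq:
  assumes u: "u \<in> L2" and xy: "0 \<le> x" "x \<le> y" "y \<le> 1"
  shows "Volterra u y - Volterra u x = (\<integral>t. indicator {x<..y} t *\<^sub>R u t \<partial>unit_leb)"
proof -
  have "Volterra u y - Volterra u x
      = (\<integral>t. indicator {0..y} t *\<^sub>R u t - indicator {0..x} t *\<^sub>R u t \<partial>unit_leb)"
    unfolding Volterra_eq_unit_leb[OF xy(3)] Volterra_eq_unit_leb[OF order_trans[OF xy(2,3)]]
    using L2_integrableD(3)[OF u] xy by (intro Bochner_Integration.integral_diff[symmetric] integrable_mult_indicator) auto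
  also have "\<dots> = (\<integral>t. indicator {x<..y} t *\<^sub>R u t \<partial>unit_leb)"
    by (intro Bochner_Integration.integral_cong) (use xy in \<open>auto simp: indicator_def\<close>)
  finally show ?thesis .
qed

lemma Volterra_0: "Volterra u 0 = 0"
  unfolding Volterra_def set_lebesgue_integral_def
  by (rule integral_eq_zero_AE, rule AE_I'[of "{0}"]) (auto simp: indicator_def)

lemma integrable_indicator_square:
  assumes u: "u \<in> L2" and xy: "0 \<le> x" "y \<le> 1"
  shows "integrable unit_leb (\<lambda>t. indicator {x<..y} t * (cmod (u t))\<^sup>2)"
proof -
  have "integrable unit_leb (\<lambda>t. indicator {x<..y} t *\<^sub>R (cmod (u t))\<^sup>2)"
    using xy L2_integrableD(2)[OF u] by (intro integrable_mult_indicator) auto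
  then show ?thesis by simp
qed

text \<open>Cauchy-Schwarz on the interval between \<open>x\<close> and \<open>y\<close>. The bound
  keeps the mass of \<open>u\<close> on that interval alone, so that it can be summed over disjoint
  cells in \<open>step_fun_Bessel\<close>.\<close>

lemma cmod_Volterra_diff_square_le:
  assumes u: "u \<in> L2" and xy: "0 \<le> x" "x \<le> y" "y \<le> 1"
  shows "(cmod (Volterra u y - Volterra u x))\<^sup>2
      \<le> (y - x) * (\<integral>t. indicator {x<..y} t * (cmod (u t))\<^sup>2 \<partial>unit_leb)"
proof -
  have "(cmod (Volterra u y - Volterra u x))\<^sup>2
      \<le> measure unit_leb {x<..y} * (\<integral>t. indicator {x<..y} t * (cmod (u t))\<^sup>2 \<partial>unit_leb)"
    unfolding Volterra_diff_eq[OF assms] using L2_integrableD[OF u] xy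
    by (intro cmod_set_integral_square_le)
      (auto simp: less_top[symmetric] finite_measure.emeasure_finite[OF finite_measure_unit_leb] intro!: sets_unit_leb_I)
  then show ?thesis
    using xy by (simp only: measure_unit_leb_Ioc)
qed

text \<open>Enlarging the local mass to the full integral turns the previous bound into Hoelder
  continuity of exponent 1/2 with constant \<open>L2_norm u\<close>.\<close>

lemma cmod_Volterra_diff_le:
  assumes u: "u \<in> L2" and xy: "0 \<le> x" "x \<le> y" "y \<le> 1"
  shows "cmod (Volterra u y - Volterra u x) \<le> sqrt (y - x) * L2_norm u"
proof -
  have "(\<integral>t. indicator {x<..y} t * (cmod (u t))\<^sup>2 \<partial>unit_leb) \<le> (\<integral>t. (cmod (u t))\<^sup>2 \<partial>unit_leb)"
    using L2_integrableD(2)[OF u] integrable_indicator_square[OF u xy(1,3)]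
    by (intro integral_mono) (auto simp: indicator_def)
  then have "(y - x) * (\<integral>t. indicator {x<..y} t * (cmod (u t))\<^sup>2 \<partial>unit_leb)
      \<le> (y - x) * (\<integral>t. (cmod (u t))\<^sup>2 \<partial>unit_leb)"
    using xy by (intro mult_left_mono) auto
  with cmod_Volterra_diff_square_le[OF assms]
  have "(cmod (Volterra u y - Volterra u x))\<^sup>2 \<le> (sqrt (y - x) * L2_norm u)\<^sup>2"
    using xy integral_unit_leb_nonneg[of u] by (simp add: power_mult_distrib L2_norm_def)
  then show ?thesis
    using xy integral_unit_leb_nonneg[of u] by (elim power2_le_imp_le) (simp add: L2_norm_def)
qed

lemma L2_bounded:
  assumes [measurable]: "f \<in> borel_measurable unit_leb" and bnd: "\<And>x. 0 \<le> x \<Longrightarrow> x \<le> 1 \<Longrightarrow> cmod (f x) \<le> B"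
  shows "f \<in> L2"
proof -
  interpret finite_measure unit_leb by (rule finite_measure_unit_leb)
  have "integrable unit_leb (\<lambda>x. (cmod (f x))\<^sup>2)"
    by (rule integrable_const_bound[where B="B\<^sup>2"]) (auto intro!: AE_I2 power_mono bnd)
  then show ?thesis by (simp add: L2_def)
qed

text \<open>The Hoelder bound gives continuity, which in turn provides the measurability of the
  limit function in \<open>Volterra_mult_in_L2\<close>.\<close>

lemma continuous_on_Volterra:
  assumes u: "u \<in> L2"
  shows "continuous_on {0..1} (Volterra u)"
  unfolding continuous_on_def
proof
  fix x :: real assume x: "x \<in> {0..1}"
  have le: "cmod (Volterra u y - Volterra u x) \<le> sqrt \<bar>y - x\<bar> * L2_norm u" if "y \<in> {0..1}" for y
    using cmod_Volterra_diff_le[OF u, of x y] cmod_Volterra_diff_le[OF u, of y x] x that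
    by (cases "x \<le> y") (auto simp: norm_minus_commute abs_if)
  have "((\<lambda>y. sqrt \<bar>y - x\<bar> * L2_norm u) \<longlongrightarrow> sqrt \<bar>x - x\<bar> * L2_norm u) (at x within {0..1})"
    by (intro tendsto_intros)
  then have "((\<lambda>y. sqrt \<bar>y - x\<bar> * L2_norm u) \<longlongrightarrow> 0) (at x within {0..1})"
    by simp
  moreover have "\<forall>\<^sub>F y in at x within {0..1}. cmod (Volterra u y - Volterra u x) \<le> sqrt \<bar>y - x\<bar> * L2_norm u"
    unfolding eventually_at_filter using le by (intro always_eventually) blast
  ultimately have "((\<lambda>y. Volterra u y - Volterra u x) \<longlongrightarrow> 0) (at x within {0..1})"
    by (rule Lim_null_comparison[rotated])
  then show "(Volterra u \<longlongrightarrow> Volterra u x) (at x within {0..1})"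
    by (rule LIM_zero_cancel)
qed

lemma cmod_Volterra_le:
  assumes u: "u \<in> L2" and x: "0 \<le> x" "x \<le> 1"
  shows "cmod (Volterra u x) \<le> L2_norm u"
proof -
  have "cmod (Volterra u x) \<le> sqrt x * L2_norm u"
    using cmod_Volterra_diff_le[OF u, of 0 x] x by (simp add: Volterra_0)
  also have "\<dots> \<le> 1 * L2_norm u"
    using x integral_unit_leb_nonneg[of u] by (intro mult_right_mono) (auto simp: L2_norm_def)
  finally show ?thesis by simp
qed

lemma Volterra_mult_in_L2:
  assumes u: "u \<in> L2"
  shows "(\<lambda>x. m * Volterra u x) \<in> L2"
proof (rule L2_bounded)
  show "(\<lambda>x. m * Volterra u x) \<in> borel_measurable unit_leb"
    by (intro continuous_imp_measurable_on_sets_lebesgue continuous_intros continuous_on_Volterra u) auto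
  show "cmod (m * Volterra u x) \<le> cmod m * L2_norm u" if "0 \<le> x" "x \<le> 1" for x
    using cmod_Volterra_le[OF u that] by (simp add: norm_mult mult_left_mono)
qed

section \<open>Step functions and their inner products with \<open>u\<close>\<close>

lemma step_fun_measurable [measurable]: "step_fun n i \<in> borel_measurable unit_leb"
proof -
  have "step_fun n i \<in> borel_measurable borel"
    unfolding step_fun_def[abs_def] by measurable
  then have "step_fun n i \<in> borel_measurable lebesgue"
    by (intro measurable_completion) simp
  then show ?thesis by (rule measurable_restrict_space1)
qed

lemma W_in_L2: "W n c \<in> L2"
proof (rule L2_bounded)
  show "W n c \<in> borel_measurable unit_leb"
    unfolding W_def[abs_def] by measurable
  show "cmod (W n c x) \<le> (\<Sum>i<n. cmod (vec_index c i) * sqrt n)" for x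
    unfolding W_def by (rule sum_norm_le) (auto simp: norm_mult step_fun_def indicator_def mult_left_mono)
qed

text \<open>The step functions live on closed intervals, so neighbours overlap at grid points. These
  are finitely many and can be discarded by this lemma.\<close>

lemma AE_unit_leb_not_in_finite:
  assumes "finite F" shows "AE x in unit_leb. x \<notin> F"
proof -
  have "F \<in> null_sets lborel"
    using assms by (simp add: finite_imp_null_set_lborel)
  then have "AE x in lebesgue. x \<notin> F"
    by (intro AE_completion AE_not_in)
  then show ?thesis
    by (subst AE_restrict_space_iff) auto
qed

text \<open>Away from the left endpoint of the cell, \<open>step_fun n (Suc j)\<close> is
  \<open>sqrt n\<close> times the indicator of a half-open interval, whose integral against
  \<open>u\<close> is an increment of the primitive.\<close>

lemma L2_inner_step_fun:
  assumes u: "u \<in> L2" and j: "j < n"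
  shows "L2_inner u (step_fun n (Suc j))
    = complex_of_real (sqrt n) * (Volterra u (real (Suc j) / n) - Volterra u (real j / n))"
proof -
  have le: "0 \<le> real j / n" "real j / n \<le> real (Suc j) / n" "real (Suc j) / n \<le> 1"
    using j by (auto simp: divide_simps)
  have [measurable]: "u \<in> borel_measurable unit_leb"
    using L2_integrableD[OF u] by auto
  have [measurable]: "{real j / n<..real (Suc j) / n} \<in> sets unit_leb"
    by (rule Ioc_sets_unit_leb[OF le(1,3)])
  have "L2_inner u (step_fun n (Suc j)) = (\<integral>x. u x * cnj (step_fun n (Suc j) x) \<partial>unit_leb)"
    by (simp add: L2_inner_def)
  also have "\<dots> = (\<integral>x. complex_of_real (sqrt n) * (indicator {real j / n<..real (Suc j) / n} x *\<^sub>R u x) \<partial>unit_leb)"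
  proof (rule integral_cong_AE)
    have "AE x in unit_leb. x \<notin> {real j / n}"
      by (rule AE_unit_leb_not_in_finite) simp
    then show "AE x in unit_leb. u x * cnj (step_fun n (Suc j) x)
        = complex_of_real (sqrt n) * (indicator {real j / n<..real (Suc j) / n} x *\<^sub>R u x)"
      by eventually_elim (auto simp: step_fun_def indicator_def)
    show "(\<lambda>x. u x * cnj (step_fun n (Suc j) x)) \<in> borel_measurable unit_leb"
      by (intro borel_measurable_times measurable_compose[OF step_fun_measurable]
        borel_measurable_continuous_onI continuous_intros) auto
    have "(\<lambda>x. indicator {real j / n<..real (Suc j) / n} x *\<^sub>R u x) \<in> borel_measurable unit_leb"
      by (intro borel_measurable_scaleR borel_measurable_indicator) fact+
    then show "(\<lambda>x. complex_of_real (sqrt n) * (indicator {real j / n<..real (Suc j) / n} x *\<^sub>R u x))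
        \<in> borel_measurable unit_leb"
      by (intro borel_measurable_times) auto
  qed
  also have "\<dots> = complex_of_real (sqrt n) * (\<integral>x. indicator {real j / n<..real (Suc j) / n} x *\<^sub>R u x \<partial>unit_leb)"
    by (rule integral_mult_right_zero)
  finally show ?thesis
    by (simp only: Volterra_diff_eq[OF u le])
qed

text \<open>The increments telescope down to the grid point \<open>0\<close>, where the primitive
  vanishes.\<close>

lemma sum_L2_inner_step_fun:
  assumes u: "u \<in> L2" and i: "i \<le> n"
  shows "(\<Sum>j<i. L2_inner u (step_fun n (Suc j))) = complex_of_real (sqrt n) * Volterra u (real i / n)"
proof -
  have "(\<Sum>j<i. L2_inner u (step_fun n (Suc j)))
      = (\<Sum>j<i. complex_of_real (sqrt n) * (Volterra u (real (Suc j) / n) - Volterra u (real j / n)))"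
    by (intro sum.cong refl L2_inner_step_fun u) (use i in auto)
  also have "\<dots> = complex_of_real (sqrt n) * (Volterra u (real i / n) - Volterra u (real 0 / n))"
    unfolding sum_distrib_left[symmetric] by (subst sum_lessThan_telescope) simp
  finally show ?thesis by (simp add: Volterra_0)
qed

text \<open>Serves to identify two cells with a common point. Both inequalities are strict as soon
  as the point lies in two half-open cells, or in one open and one closed cell.\<close>

lemma cell_unique:
  fixes i j n :: nat
  assumes "real i / n < real (Suc j) / n" "real j / n < real (Suc i) / n"
  shows "i = j"
proof -
  \<comment> \<open>For \<open>n = 0\<close> both quotients are \<open>0\<close> by convention,
    contradicting the strict inequality.\<close>
  have n: "real n > 0"
    using assms(1) by (cases "n = 0") auto
  have "real i < real (Suc j)" "real j < real (Suc i)"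
    using assms n by (simp_all only: divide_less_cancel)
  then show ?thesis by linarith
qed

text \<open>Each squared coefficient is \<open>n\<close> times a squared increment of the primitive.
  The cell length \<open>1 / n\<close> cancels the factor \<open>n\<close>, leaving the mass of
  \<open>u\<close> on the cell; the cells are disjoint, so these masses add up to at most the
  total.\<close>

lemma step_fun_Bessel:
  assumes u: "u \<in> L2"
  shows "(\<Sum>j<n. (cmod (L2_inner u (step_fun n (Suc j))))\<^sup>2) \<le> (L2_norm u)\<^sup>2"
proof -
  \<comment> \<open>Half-open cells are disjoint exactly, not only up to null sets.\<close>
  define A where "A j = {real j / n<..real (Suc j) / n}" for j
  have int: "integrable unit_leb (\<lambda>t. indicator (A j) t * (cmod (u t))\<^sup>2)" if "j < n" for j
    unfolding A_def using that by (intro integrable_indicator_square u) (auto simp: divide_simps)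
  have disj: "disjoint_family_on A {..<n}"
    unfolding disjoint_family_on_def
  proof (intro ballI impI)
    fix i j :: nat assume "i \<noteq> j"
    show "A i \<inter> A j = {}"
    proof (rule equals0I)
      fix x assume "x \<in> A i \<inter> A j"
      then have "real i / n < real (Suc j) / n" "real j / n < real (Suc i) / n"
        unfolding A_def by (simp_all del: of_nat_Suc)
      then show False using cell_unique \<open>i \<noteq> j\<close> by blast
    qed
  qed
  have "(\<Sum>j<n. (cmod (L2_inner u (step_fun n (Suc j))))\<^sup>2)
      \<le> (\<Sum>j<n. \<integral>t. indicator (A j) t * (cmod (u t))\<^sup>2 \<partial>unit_leb)"
  proof (rule sum_mono)
    fix j assume j: "j \<in> {..<n}"
    then have le: "0 \<le> real j / n" "real j / n \<le> real (Suc j) / n" "real (Suc j) / n \<le> 1"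
      by (auto simp: divide_simps)
    have diff: "real (Suc j) / n - real j / n = 1 / n"
      by (simp add: add_divide_distrib)
    have "(cmod (L2_inner u (step_fun n (Suc j))))\<^sup>2
        = n * (cmod (Volterra u (real (Suc j) / n) - Volterra u (real j / n)))\<^sup>2"
      using j by (subst L2_inner_step_fun[OF u]) (auto simp: norm_mult power_mult_distrib)
    also have "\<dots> \<le> n * (1 / n * (\<integral>t. indicator (A j) t * (cmod (u t))\<^sup>2 \<partial>unit_leb))"
      using cmod_Volterra_diff_square_le[OF u le] unfolding diff A_def by (intro mult_left_mono) auto
    finally show "(cmod (L2_inner u (step_fun n (Suc j))))\<^sup>2 \<le> (\<integral>t. indicator (A j) t * (cmod (u t))\<^sup>2 \<partial>unit_leb)"
      using j by simp
  qed
  also have "\<dots> = (\<integral>t. (\<Sum>j<n. indicator (A j) t * (cmod (u t))\<^sup>2) \<partial>unit_leb)"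
    by (rule Bochner_Integration.integral_sum[symmetric]) (use int in auto)
  also have "\<dots> \<le> (\<integral>t. (cmod (u t))\<^sup>2 \<partial>unit_leb)"
  proof (rule integral_mono)
    show "integrable unit_leb (\<lambda>t. \<Sum>j<n. indicator (A j) t * (cmod (u t))\<^sup>2)"
      by (rule Bochner_Integration.integrable_sum) (use int in auto)
    fix t
    have "(\<Sum>j<n. indicator (A j) t * (cmod (u t))\<^sup>2) = indicator (\<Union>j<n. A j) t * (cmod (u t))\<^sup>2"
      by (simp only: indicator_UN_disjoint[OF finite_lessThan disj] sum_distrib_right)
    also have "\<dots> \<le> 1 * (cmod (u t))\<^sup>2"
      by (intro mult_right_mono indicator_le_1) simp
    finally show "(\<Sum>j<n. indicator (A j) t * (cmod (u t))\<^sup>2) \<le> (cmod (u t))\<^sup>2"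
      by simp
  qed (use L2_integrableD[OF u] in auto)
  also have "\<dots> = (L2_norm u)\<^sup>2"
    using integral_unit_leb_nonneg[of u] by (simp add: L2_norm_def)
  finally show ?thesis .
qed

section \<open>The isometry \<open>W\<close>, cell by cell\<close>

lemma AE_unit_leb_cell:
  assumes n: "n > 0"
  shows "AE x in unit_leb. \<exists>i<n. real i / n < x \<and> x < real (Suc i) / n"
proof -
  have "AE x in unit_leb. x \<notin> (\<lambda>i. real i / n) ` {..n}"
    by (rule AE_unit_leb_not_in_finite) simp
  then show ?thesis
    using AE_space
  proof eventually_elim
    case (elim x)
    then have x: "0 \<le> x" "x \<le> 1" by auto
    \<comment> \<open>The floor gives the cell that contains \<open>x\<close> with its left
      endpoint. Avoiding the grid makes the left inequality strict and rules out
      \<open>i = n\<close>, which would mean \<open>x = 1\<close>.\<close>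
    define i where "i = nat \<lfloor>x * n\<rfloor>"
    have fl: "real i \<le> x * n" "x * n < real i + 1"
      using x n by (auto simp: i_def)
    have "x * n \<le> n" using x n by simp
    then have "i \<le> n" using fl by linarith
    then have ne: "real i / n \<noteq> x" "real n / n \<noteq> x" using elim(1) by auto
    then have "i < n" using fl \<open>i \<le> n\<close> n x by (cases "i = n") auto
    moreover have "real i / n < x" using ne(1) fl(1) n by (auto simp: field_simps)
    moreover have "x < real (Suc i) / n" using fl(2) n by (auto simp: field_simps)
    ultimately show ?case by blast
  qed
qed

text \<open>In the interior of a cell exactly one step function is nonzero; at a grid point two of
  them could contribute, hence the strict inequalities.\<close>

lemma W_cell:
  assumes i: "i < n" and x: "real i / n < x" "x < real (Suc i) / n"
  shows "W n c x = complex_of_real (sqrt n) * vec_index c i"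
proof -
  have "step_fun n (Suc j) x = (if j = i then complex_of_real (sqrt n) else 0)" for j
  proof (cases "j = i")
    case True
    then show ?thesis using x by (simp add: step_fun_def indicator_def)
  next
    case False
    have *: "\<not> (real j / n \<le> x \<and> x \<le> real (Suc j) / n)"
    proof
      assume "real j / n \<le> x \<and> x \<le> real (Suc j) / n"
      then have "real j / n < real (Suc i) / n" "real i / n < real (Suc j) / n"
        using x by auto
      then show False using cell_unique False by blast
    qed
    then show ?thesis using False by (simp add: step_fun_def indicator_def)
  qed
  then have "W n c x = (\<Sum>j<n. if j = i then complex_of_real (sqrt n) * vec_index c i else 0)"
    unfolding W_def by (intro sum.cong) auto
  then show ?thesis using i by simp
qed

text \<open>This is the isometry property of \<open>W\<close>: almost everywhere the squared modulus
  is the simple function with value \<open>n\<close> times the squared modulus of the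
  \<open>i\<close>-th coordinate on the \<open>i\<close>-th cell, and each cell has measure
  \<open>1 / n\<close>.\<close>

lemma integral_W_square:
  assumes n: "n > 0"
  shows "(\<integral>x. (cmod (W n c x))\<^sup>2 \<partial>unit_leb) = (\<Sum>i<n. (cmod (vec_index c i))\<^sup>2)"
proof -
  define A where "A i = {real i / n<..real (Suc i) / n}" for i
  have A: "A i \<in> sets unit_leb" "measure unit_leb (A i) = 1 / n" if "i < n" for i
  proof -
    have le: "0 \<le> real i / n" "real i / n \<le> real (Suc i) / n" "real (Suc i) / n \<le> 1"
      using that by (auto simp: divide_simps)
    show "A i \<in> sets unit_leb"
      unfolding A_def by (rule Ioc_sets_unit_leb[OF le(1,3)])
    show "measure unit_leb (A i) = 1 / n"
      unfolding A_def using n by (subst measure_unit_leb_Ioc[OF le]) (simp add: field_simps)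
  qed
  have "(\<integral>x. (cmod (W n c x))\<^sup>2 \<partial>unit_leb)
      = (\<integral>x. (\<Sum>i<n. n * (cmod (vec_index c i))\<^sup>2 * indicator (A i) x) \<partial>unit_leb)"
  proof (rule integral_cong_AE)
    show "(\<lambda>x. (cmod (W n c x))\<^sup>2) \<in> borel_measurable unit_leb"
      using L2_integrableD[OF W_in_L2] by measurable
    show "(\<lambda>x. \<Sum>i<n. n * (cmod (vec_index c i))\<^sup>2 * indicator (A i) x) \<in> borel_measurable unit_leb"
      using A by (intro borel_measurable_sum borel_measurable_times borel_measurable_indicator) auto
    show "AE x in unit_leb. (cmod (W n c x))\<^sup>2 = (\<Sum>i<n. n * (cmod (vec_index c i))\<^sup>2 * indicator (A i) x)"
      using AE_unit_leb_cell[OF n]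
    proof eventually_elim
      case (elim x)
      then obtain i where i: "i < n" "real i / n < x" "x < real (Suc i) / n" by auto
      have *: "indicator (A j) x = (if j = i then 1 else 0 :: real)" for j
      proof -
        have "j = i" if "x \<in> A j"
        proof (rule cell_unique)
          show "real j / n < real (Suc i) / n" "real i / n < real (Suc j) / n"
            using i that unfolding A_def by (simp_all del: of_nat_Suc)
        qed
        moreover have "x \<in> A i"
          using i unfolding A_def by (simp del: of_nat_Suc)
        ultimately have "x \<in> A j \<longleftrightarrow> j = i" by blast
        then show ?thesis by (simp add: indicator_def)
      qed
      have "(\<Sum>j<n. n * (cmod (vec_index c j))\<^sup>2 * indicator (A j) x)
          = (\<Sum>j<n. if j = i then n * (cmod (vec_index c i))\<^sup>2 else 0)"
        by (rule sum.cong) (simp_all add: *)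
      also have "\<dots> = n * (cmod (vec_index c i))\<^sup>2"
        using i(1) by simp
      finally show ?case
        using W_cell[OF i, of c] by (simp add: norm_mult power_mult_distrib)
    qed
  qed
  also have "\<dots> = (\<Sum>i<n. \<integral>x. n * (cmod (vec_index c i))\<^sup>2 * indicator (A i) x \<partial>unit_leb)"
    using A finite_measure.emeasure_finite[OF finite_measure_unit_leb]
    by (intro Bochner_Integration.integral_sum integrable_mult_right integrable_real_indicator) (auto simp: less_top[symmetric])
  also have "\<dots> = (\<Sum>i<n. (cmod (vec_index c i))\<^sup>2)"
  proof (intro sum.cong refl)
    fix i assume i: "i \<in> {..<n}"
    then have sub: "A i \<subseteq> {0..1}" using sets.sets_into_space[OF A(1)] by simp
    have "(\<integral>x. n * (cmod (vec_index c i))\<^sup>2 * indicator (A i) x \<partial>unit_leb)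
        = n * (cmod (vec_index c i))\<^sup>2 * measure unit_leb (A i \<inter> space unit_leb)"
      by (subst integral_mult_right_zero, subst Bochner_Integration.integral_indicator) simp
    also have "A i \<inter> space unit_leb = A i" using sub by auto
    also have "n * (cmod (vec_index c i))\<^sup>2 * measure unit_leb (A i) = (cmod (vec_index c i))\<^sup>2"
      using A(2)[of i] i n by simp
    finally show "(\<integral>x. n * (cmod (vec_index c i))\<^sup>2 * indicator (A i) x \<partial>unit_leb) = (cmod (vec_index c i))\<^sup>2" .
  qed
  finally show ?thesis .
qed

section \<open>Deterministic error bound\<close>

text \<open>Here \<open>z\<close> stands for the centred noise, \<open>m\<close> for the mean at
  size \<open>n\<close> and \<open>m'\<close> for its limit. The noise is measured by the isometry,
  while the mean part is compared with \<open>m' * Volterra u\<close> uniformly, by Hoelder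
  continuity and boundedness of the primitive.\<close>

lemma L2_norm_W_minus_Volterra:
  assumes u: "u \<in> L2" and n: "n > 0"
    and Y: "\<And>i. i < n \<Longrightarrow> vec_index y i = z i + m / of_nat n * (\<Sum>j<Suc i. L2_inner u (step_fun n (Suc j)))"
  shows "(L2_norm (\<lambda>x. W n y x - m' * Volterra u x))\<^sup>2
    \<le> 2 * (\<Sum>i<n. (cmod (z i))\<^sup>2) + 2 * ((cmod m / sqrt n + cmod (m - m')) * L2_norm u)\<^sup>2"
proof -
  interpret finite_measure unit_leb by (rule finite_measure_unit_leb)
  define v where "v = Matrix.vec n z"
  define B where "B = ((cmod m / sqrt n + cmod (m - m')) * L2_norm u)\<^sup>2"
  have iW: "integrable unit_leb (\<lambda>x. (cmod (W n v x))\<^sup>2)"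
    by (rule L2_integrableD[OF W_in_L2])
  have [measurable]: "W n y \<in> borel_measurable unit_leb" "(\<lambda>x. m' * Volterra u x) \<in> borel_measurable unit_leb"
    using L2_integrableD(1)[OF W_in_L2] L2_integrableD(1)[OF Volterra_mult_in_L2[OF u]] by auto
  have bound: "AE x in unit_leb. (cmod (W n y x - m' * Volterra u x))\<^sup>2 \<le> 2 * (cmod (W n v x))\<^sup>2 + 2 * B"
    using AE_unit_leb_cell[OF n] AE_space
  proof eventually_elim
    case (elim x)
    then obtain i where i: "i < n" "real i / n < x" "x < real (Suc i) / n" by auto
    have x: "0 \<le> x" "x \<le> 1" using elim by auto
    have sn: "real (Suc i) / n \<le> 1" using i(1) by (simp add: divide_simps)
    have U: "0 \<le> L2_norm u" using integral_unit_leb_nonneg[of u] by (simp add: L2_norm_def)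
    \<comment> \<open>Row \<open>i\<close> sums through index \<open>i\<close> inclusive, so the
      primitive is sampled at the right endpoint of the cell. The error splits into noise
      \<open>?p\<close>, a sampling error and the error in the mean.\<close>
    let ?p = "W n v x" and ?q = "m * (Volterra u (real (Suc i) / n) - Volterra u x) + (m - m') * Volterra u x"
    have sq: "complex_of_real (sqrt n) * complex_of_real (sqrt n) = of_nat n"
      by (simp flip: of_real_mult)
    \<comment> \<open>One factor \<open>sqrt n\<close> comes from \<open>W\<close>, the other from
      the telescoped inner products; together they cancel the scaling \<open>1 / n\<close> of the
      matrix.\<close>
    have "complex_of_real (sqrt n) * (m / of_nat n * (complex_of_real (sqrt n) * V))
        = m * V" for V
      using n sq by (simp add: field_simps)
    then have "W n y x = ?p + m * Volterra u (real (Suc i) / n)"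
      using i(1) sum_L2_inner_step_fun[OF u, of "Suc i" n]
      unfolding W_cell[OF i] Y[OF i(1)] by (simp add: v_def distrib_left)
    then have eq: "W n y x - m' * Volterra u x = ?p + ?q"
      by (simp add: algebra_simps)
    have "cmod (Volterra u (real (Suc i) / n) - Volterra u x) \<le> sqrt (real (Suc i) / n - x) * L2_norm u"
      using i sn x by (intro cmod_Volterra_diff_le u) auto
    also have "\<dots> \<le> sqrt (1 / n) * L2_norm u"
      using i n U by (intro mult_right_mono) (auto simp: field_simps)
    finally have 1: "cmod (m * (Volterra u (real (Suc i) / n) - Volterra u x)) \<le> cmod m * (sqrt (1 / n) * L2_norm u)"
      by (simp only: norm_mult mult_left_mono norm_ge_zero)
    have 2: "cmod ((m - m') * Volterra u x) \<le> cmod (m - m') * L2_norm u"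
      unfolding norm_mult by (intro mult_left_mono cmod_Volterra_le u x) auto
    have "cmod ?q \<le> (cmod m / sqrt n + cmod (m - m')) * L2_norm u"
      using norm_triangle_mono[OF 1 2] by (simp add: algebra_simps real_sqrt_divide)
    then have "(cmod ?q)\<^sup>2 \<le> B"
      unfolding B_def by (intro power_mono) auto
    moreover have "(cmod (?p + ?q))\<^sup>2 \<le> (cmod ?p + cmod ?q)\<^sup>2"
      by (intro power_mono norm_triangle_ineq) auto
    moreover have "(cmod ?p + cmod ?q)\<^sup>2 \<le> 2 * (cmod ?p)\<^sup>2 + 2 * (cmod ?q)\<^sup>2"
      using sum_squares_bound[of "cmod ?p" "cmod ?q"] by (simp add: power2_sum)
    ultimately show ?case unfolding eq by linarith
  qed
  have iD: "integrable unit_leb (\<lambda>x. 2 * (cmod (W n v x))\<^sup>2 + 2 * B)"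
    using iW by auto
  have "(L2_norm (\<lambda>x. W n y x - m' * Volterra u x))\<^sup>2 = (\<integral>x. (cmod (W n y x - m' * Volterra u x))\<^sup>2 \<partial>unit_leb)"
    by (simp add: L2_norm_def integral_unit_leb_nonneg)
  also have "\<dots> \<le> (\<integral>x. 2 * (cmod (W n v x))\<^sup>2 + 2 * B \<partial>unit_leb)"
  proof (rule integral_mono_AE[OF _ iD bound])
    show "integrable unit_leb (\<lambda>x. (cmod (W n y x - m' * Volterra u x))\<^sup>2)"
      using bound by (intro Bochner_Integration.integrable_bound[OF iD]) (auto elim: eventually_mono)
  qed
  also have "\<dots> = 2 * (\<integral>x. (cmod (W n v x))\<^sup>2 \<partial>unit_leb) + 2 * B"
  proof -
    \<comment> \<open>The unit interval has total mass one, so the constant \<open>2 * B\<close>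
      integrates to itself.\<close>
    have "measure unit_leb {0..1} = 1" using measure_unit_leb_Icc[of 0 1] by simp
    then show ?thesis using iW by simp
  qed
  also have "(\<integral>x. (cmod (W n v x))\<^sup>2 \<partial>unit_leb) = (\<Sum>i<n. (cmod (z i))\<^sup>2)"
    by (simp add: integral_W_square[OF n] v_def)
  finally show ?thesis by (simp add: B_def)
qed

section \<open>Second moment of the centred remainder\<close>

text \<open>The centred entries of one row form an independent family of mean zero and common
  variance, so \<open>expectation_cmod_sum_square_indep\<close> applies once the row is viewed as a
  set \<open>J\<close> of index pairs.\<close>

lemma (in prob_space) expectation_row_square:
  assumes indep: "indep_vars (\<lambda>_. borel) (\<lambda>(i, j). Y i j) (lower_tri_indices n)"
    and int: "\<And>i j. (i, j) \<in> lower_tri_indices n \<Longrightarrow> integrable M (Y i j)"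
    and mean: "\<And>i j. (i, j) \<in> lower_tri_indices n \<Longrightarrow> expectation (Y i j) = m"
    and int2: "\<And>i j. (i, j) \<in> lower_tri_indices n \<Longrightarrow> integrable M (\<lambda>\<omega>. (cmod (Y i j \<omega> - m))\<^sup>2)"
    and var: "\<And>i j. (i, j) \<in> lower_tri_indices n \<Longrightarrow> expectation (\<lambda>\<omega>. (cmod (Y i j \<omega> - m))\<^sup>2) = s\<^sup>2"
    and i: "i < n"
  shows "integrable M (\<lambda>\<omega>. (cmod (\<Sum>j<Suc i. c j * (Y (Suc i) (Suc j) \<omega> - m)))\<^sup>2)"
    and "expectation (\<lambda>\<omega>. (cmod (\<Sum>j<Suc i. c j * (Y (Suc i) (Suc j) \<omega> - m)))\<^sup>2) = s\<^sup>2 * (\<Sum>j<Suc i. (cmod (c j))\<^sup>2)"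
proof -
  define J where "J = (\<lambda>j. (Suc i, Suc j)) ` {..<Suc i}"
  \<comment> \<open>Entries are numbered from \<open>1\<close> and coefficients from
    \<open>0\<close>; subtracting one undoes the shift.\<close>
  define C where "C = (\<lambda>p :: nat \<times> nat. c (snd p - 1))"
  define V where "V = (\<lambda>p \<omega>. Y (fst p) (snd p) \<omega> - m)"
  have J: "J \<subseteq> lower_tri_indices n" and fin: "finite J"
    using i by (auto simp: J_def lower_tri_indices_def)
  have inj: "inj_on (\<lambda>j. (Suc i, Suc j)) {..<Suc i}"
    by (auto simp: inj_on_def)
  have "indep_vars (\<lambda>_. borel) (\<lambda>(i, j). Y i j) J"
    using indep J by (rule indep_vars_subset)
  then have "indep_vars (\<lambda>_. borel) (\<lambda>p \<omega>. (case p of (i, j) \<Rightarrow> Y i j) \<omega> - m) J"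
    by (rule indep_vars_compose2) auto
  then have V: "indep_vars (\<lambda>_. borel) V J"
    by (simp add: V_def case_prod_beta)
  have mem: "(fst p, snd p) \<in> lower_tri_indices n" if "p \<in> J" for p
    using J that by auto
  have V_int: "integrable M (V p)" if "p \<in> J" for p
    unfolding V_def using int[OF mem[OF that]] by auto
  have V_mean: "expectation (V p) = 0" if "p \<in> J" for p
    unfolding V_def using int[OF mem[OF that]] mean[OF mem[OF that]] by (simp add: prob_space)
  have V_int2: "integrable M (\<lambda>\<omega>. (cmod (V p \<omega>))\<^sup>2)" if "p \<in> J" for p
    unfolding V_def using int2[OF mem[OF that]] .
  have V_var: "expectation (\<lambda>\<omega>. (cmod (V p \<omega>))\<^sup>2) = s\<^sup>2" if "p \<in> J" for p
    unfolding V_def using var[OF mem[OF that]] .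
  have eq: "(\<Sum>p\<in>J. C p * V p \<omega>) = (\<Sum>j<Suc i. c j * (Y (Suc i) (Suc j) \<omega> - m))" for \<omega>
    unfolding J_def by (subst sum.reindex[OF inj]) (simp add: C_def V_def)
  have eq2: "(\<Sum>p\<in>J. (cmod (C p))\<^sup>2) = (\<Sum>j<Suc i. (cmod (c j))\<^sup>2)"
    unfolding J_def by (subst sum.reindex[OF inj]) (simp add: C_def)
  note * = expectation_cmod_sum_square_indep[OF fin V V_int V_mean V_int2, of C]
  show "integrable M (\<lambda>\<omega>. (cmod (\<Sum>j<Suc i. c j * (Y (Suc i) (Suc j) \<omega> - m)))\<^sup>2)"
    using *(1) unfolding eq .
  have "(\<Sum>p\<in>J. (cmod (C p))\<^sup>2 * expectation (\<lambda>\<omega>. (cmod (V p \<omega>))\<^sup>2)) = s\<^sup>2 * (\<Sum>p\<in>J. (cmod (C p))\<^sup>2)"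
    by (simp add: V_var sum_distrib_left mult.commute)
  then show "expectation (\<lambda>\<omega>. (cmod (\<Sum>j<Suc i. c j * (Y (Suc i) (Suc j) \<omega> - m)))\<^sup>2) = s\<^sup>2 * (\<Sum>j<Suc i. (cmod (c j))\<^sup>2)"
    using *(2) unfolding eq eq2 by simp
qed

text \<open>Each row contributes \<open>s^2 / n^2\<close> times a partial sum of squared
  coefficients, which is at most the full sum. Adding \<open>n\<close> rows leaves the factor
  \<open>s^2 / n\<close>.\<close>

lemma (in prob_space) expectation_triangular_square_le:
  fixes Y :: "nat \<Rightarrow> nat \<Rightarrow> 'a \<Rightarrow> complex" and c :: "nat \<Rightarrow> complex"
  assumes indep: "indep_vars (\<lambda>_. borel) (\<lambda>(i, j). Y i j) (lower_tri_indices n)"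
    and int: "\<And>i j. (i, j) \<in> lower_tri_indices n \<Longrightarrow> integrable M (Y i j)"
    and mean: "\<And>i j. (i, j) \<in> lower_tri_indices n \<Longrightarrow> expectation (Y i j) = m"
    and int2: "\<And>i j. (i, j) \<in> lower_tri_indices n \<Longrightarrow> integrable M (\<lambda>\<omega>. (cmod (Y i j \<omega> - m))\<^sup>2)"
    and var: "\<And>i j. (i, j) \<in> lower_tri_indices n \<Longrightarrow> expectation (\<lambda>\<omega>. (cmod (Y i j \<omega> - m))\<^sup>2) = s\<^sup>2"
    and n: "n > 0"
  defines "R \<equiv> \<lambda>\<omega>. \<Sum>i<n. (cmod (1 / of_nat n * (\<Sum>j<Suc i. c j * (Y (Suc i) (Suc j) \<omega> - m))))\<^sup>2"
  shows "integrable M R" and "expectation R \<le> s\<^sup>2 / n * (\<Sum>j<n. (cmod (c j))\<^sup>2)"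
proof -
  have row: "integrable M (\<lambda>\<omega>. (cmod (\<Sum>j<Suc i. c j * (Y (Suc i) (Suc j) \<omega> - m)))\<^sup>2)"
    "expectation (\<lambda>\<omega>. (cmod (\<Sum>j<Suc i. c j * (Y (Suc i) (Suc j) \<omega> - m)))\<^sup>2) = s\<^sup>2 * (\<Sum>j<Suc i. (cmod (c j))\<^sup>2)"
    if "i < n" for i
    using expectation_row_square[OF indep int mean int2 var that, of c] by blast+
  have R: "R = (\<lambda>\<omega>. \<Sum>i<n. (1 / n)\<^sup>2 * (cmod (\<Sum>j<Suc i. c j * (Y (Suc i) (Suc j) \<omega> - m)))\<^sup>2)"
    unfolding R_def norm_mult power_mult_distrib by (simp add: norm_divide)
  show "integrable M R"
    unfolding R by (intro Bochner_Integration.integrable_sum integrable_mult_right row(1)) auto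
  have "expectation R = (\<Sum>i<n. expectation (\<lambda>\<omega>. (1 / n)\<^sup>2 * (cmod (\<Sum>j<Suc i. c j * (Y (Suc i) (Suc j) \<omega> - m)))\<^sup>2))"
    unfolding R by (intro Bochner_Integration.integral_sum integrable_mult_right row(1)) auto
  also have "\<dots> = (\<Sum>i<n. (1 / n)\<^sup>2 * (s\<^sup>2 * (\<Sum>j<Suc i. (cmod (c j))\<^sup>2)))"
  proof (intro sum.cong refl)
    fix i assume "i \<in> {..<n}"
    then have "i < n" by simp
    show "expectation (\<lambda>\<omega>. (1 / n)\<^sup>2 * (cmod (\<Sum>j<Suc i. c j * (Y (Suc i) (Suc j) \<omega> - m)))\<^sup>2)
        = (1 / n)\<^sup>2 * (s\<^sup>2 * (\<Sum>j<Suc i. (cmod (c j))\<^sup>2))"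
      unfolding integral_mult_right_zero row(2)[OF \<open>i < n\<close>] ..
  qed
  also have "\<dots> \<le> (\<Sum>i<n. (1 / n)\<^sup>2 * (s\<^sup>2 * (\<Sum>j<n. (cmod (c j))\<^sup>2)))"
    by (intro sum_mono mult_left_mono sum_mono2) auto
  also have "\<dots> = s\<^sup>2 / n * (\<Sum>j<n. (cmod (c j))\<^sup>2)"
    using n by (simp add: power2_eq_square)
  finally show "expectation R \<le> s\<^sup>2 / n * (\<Sum>j<n. (cmod (c j))\<^sup>2)" .
qed

text \<open>Entries above the diagonal vanish, which truncates the row sum at the diagonal. Writing
  each remaining entry as \<open>(Y - m) + m\<close> yields the noise-plus-mean form expected by
  \<open>L2_norm_W_minus_Volterra\<close>.\<close>

lemma scaled_mat_mult_W_adj_index: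
  assumes i: "i < n" and upper: "\<And>j. Suc i < j \<Longrightarrow> j \<le> n \<Longrightarrow> Y (Suc i) j = 0"
  shows "vec_index (scaled_mat n Y *\<^sub>v W_adj n u) i =
    1 / of_nat n * (\<Sum>j<Suc i. L2_inner u (step_fun n (Suc j)) * (Y (Suc i) (Suc j) - m))
    + m / of_nat n * (\<Sum>j<Suc i. L2_inner u (step_fun n (Suc j)))"
proof -
  have "vec_index (scaled_mat n Y *\<^sub>v W_adj n u) i
      = (\<Sum>j<n. 1 / of_nat n * (L2_inner u (step_fun n (Suc j)) * Y (Suc i) (Suc j)))"
    using i by (simp add: scaled_mat_def W_adj_def scalar_prod_def atLeast0LessThan mult.commute)
  also have "\<dots> = (\<Sum>j<Suc i. 1 / of_nat n * (L2_inner u (step_fun n (Suc j)) * Y (Suc i) (Suc j)))"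
    using i upper by (intro sum.mono_neutral_right) auto
  also have "\<dots> = (\<Sum>j<Suc i. 1 / of_nat n * (L2_inner u (step_fun n (Suc j)) * (Y (Suc i) (Suc j) - m))
      + m / of_nat n * L2_inner u (step_fun n (Suc j)))"
    by (intro sum.cong refl) (simp add: algebra_simps diff_divide_distrib)
  finally show ?thesis
    by (simp only: sum.distrib sum_distrib_left)
qed

text \<open>Comparison with the series of \<open>1 / k^2\<close>, after dividing the bound by
  \<open>k^2\<close>.\<close>

lemma suminf_finite_if_mult_square_bounded:
  fixes e k :: "nat \<Rightarrow> real"
  assumes k: "\<And>n. 0 \<le> k n" and sum: "(\<Sum>n. 1 / (ennreal (k n))\<^sup>2) < \<infinity>"
    and bound: "\<And>n. e n * (k n)\<^sup>2 \<le> B"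
  shows "(\<Sum>n. ennreal (e n)) < \<infinity>"
proof -
  have le: "ennreal (e n) \<le> ennreal B * (1 / (ennreal (k n))\<^sup>2)" for n
  proof -
    \<comment> \<open>In the extended nonnegative reals \<open>1 / 0\<close> is infinite, so a zero
      of \<open>k\<close> would make the series diverge.\<close>
    have "k n \<noteq> 0"
    proof
      assume "k n = 0"
      then have "\<infinity> \<le> (\<Sum>n. 1 / (ennreal (k n))\<^sup>2)"
        using sum_le_suminf[OF summableI, of "{n}" "\<lambda>n. 1 / (ennreal (k n))\<^sup>2"] by simp
      then show False using sum by simp
    qed
    then have pos: "k n > 0" using k[of n] by simp
    then have "e n \<le> B * (1 / (k n)\<^sup>2)" using bound[of n] by (simp add: field_simps)
    then have "ennreal (e n) \<le> ennreal (B * (1 / (k n)\<^sup>2))" by (rule ennreal_leI)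
    also have "\<dots> = ennreal B * ennreal (1 / (k n)\<^sup>2)"
      by (rule ennreal_mult'') simp
    also have "ennreal (1 / (k n)\<^sup>2) = 1 / (ennreal (k n))\<^sup>2"
      using pos by (subst divide_ennreal[symmetric]) (auto simp: ennreal_power)
    finally show ?thesis .
  qed
  have "(\<Sum>n. ennreal (e n)) \<le> (\<Sum>n. ennreal B * (1 / (ennreal (k n))\<^sup>2))"
    by (intro suminf_le le summableI)
  also have "\<dots> = ennreal B * (\<Sum>n. 1 / (ennreal (k n))\<^sup>2)"
    by (rule ennreal_suminf_cmult)
  also have "\<dots> < \<infinity>"
    using sum by (simp add: ennreal_mult_less_top)
  finally show ?thesis .
qed

section \<open>Almost sure convergence along the subsequence\<close>

theorem theorem1p1:
  fixes M :: "'w measure"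
    and X :: "nat \<Rightarrow> nat \<Rightarrow> nat \<Rightarrow> 'w \<Rightarrow> complex"
    and \<mu> :: "nat \<Rightarrow> complex" and \<sigma> :: "nat \<Rightarrow> real"
    and a :: "nat \<Rightarrow> nat" and k :: "nat \<Rightarrow> real"
    and \<mu>_lim :: complex and u :: "real \<Rightarrow> complex"
  assumes "prob_space M"
    and indep: "\<And>N. N \<ge> 1 \<Longrightarrow>
      prob_space.indep_vars M (\<lambda>_. borel) (\<lambda>(i, j). X N i j) (lower_tri_indices N)"
    and ident: "\<And>N i j i' j'. N \<ge> 1 \<Longrightarrow> (i, j) \<in> lower_tri_indices N \<Longrightarrow> (i', j') \<in> lower_tri_indices N \<Longrightarrow>
      distr M borel (X N i j) = distr M borel (X N i' j')"
    and upper: "\<And>N i j \<omega>. 1 \<le> i \<Longrightarrow> i < j \<Longrightarrow> j \<le> N \<Longrightarrow> \<omega> \<in> space M \<Longrightarrow> X N i j \<omega> = 0"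
    and mean: "\<And>N i j. N \<ge> 1 \<Longrightarrow> (i, j) \<in> lower_tri_indices N \<Longrightarrow>
      integrable M (X N i j) \<and> \<mu> N = integral\<^sup>L M (X N i j)"
    and variance: "\<And>N i j. N \<ge> 1 \<Longrightarrow> (i, j) \<in> lower_tri_indices N \<Longrightarrow>
      integrable M (\<lambda>\<omega>. (cmod (X N i j \<omega> - \<mu> N))\<^sup>2) \<and>
      (\<sigma> N)\<^sup>2 = integral\<^sup>L M (\<lambda>\<omega>. (cmod (X N i j \<omega> - \<mu> N))\<^sup>2)"
    and "\<And>N. N \<ge> 1 \<Longrightarrow> \<sigma> N \<ge> 0"
    and "strict_mono a" and "\<And>N. a N > 0"
    and "\<And>N. N \<ge> 1 \<Longrightarrow> k N \<ge> 0"
    and "(\<lambda>N. k N * \<sigma> (a N) / sqrt (real (a N))) \<longlonglongrightarrow> 0"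
    and "(\<Sum>N. 1 / (ennreal (k (Suc N)))\<^sup>2) < \<infinity>"
    and "(\<lambda>N. \<mu> (a N)) \<longlonglongrightarrow> \<mu>_lim"
    and "u \<in> L2"
  shows "AE \<omega> in M. L2_tendsto
    (\<lambda>N. W (a N) (scaled_mat (a N) (\<lambda>i j. X (a N) i j \<omega>) *\<^sub>v W_adj (a N) u))
    (\<lambda>x. \<mu>_lim * Volterra u x)"
proof -
  interpret prob_space M by fact
  note k_nonneg = assms(10) and ratio = assms(11) and k_sum = assms(12)
    and mu_lim = assms(13) and u = assms(14)
  have a1: "a N \<ge> 1" and a0: "a N > 0" for N
    using \<open>\<And>N. a N > 0\<close>[of N] by auto
  define c where "c N j = L2_inner u (step_fun (a N) (Suc j))" for N j
  define Z where "Z N i \<omega> = 1 / of_nat (a N) * (\<Sum>j<Suc i. c N j * (X (a N) (Suc i) (Suc j) \<omega> - \<mu> (a N)))"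
    for N i \<omega>
  \<comment> \<open>By the isometry property, \<open>R N\<close> is the squared norm of the function
    that \<open>W\<close> builds from the centred remainders \<open>Z N i\<close>.\<close>
  define R where "R N = (\<lambda>\<omega>. \<Sum>i<a N. (cmod (Z N i \<omega>))\<^sup>2)" for N
  have R_int: "integrable M (R N)"
    and R_le: "expectation (R N) \<le> (\<sigma> (a N))\<^sup>2 / a N * (L2_norm u)\<^sup>2" for N
  proof -
    note m = mean[OF a1, THEN conjunct1] mean[OF a1, THEN conjunct2, symmetric]
      variance[OF a1, THEN conjunct1] variance[OF a1, THEN conjunct2, symmetric]
    have "integrable M (R N)"
      unfolding R_def Z_def
      by (rule expectation_triangular_square_le(1)[OF indep[OF a1]], erule m(1), erule m(2), erule m(3), erule m(4), rule a0)
    moreover have "expectation (R N) \<le> (\<sigma> (a N))\<^sup>2 / a N * (\<Sum>j<a N. (cmod (c N j))\<^sup>2)"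
      unfolding R_def Z_def
      by (rule expectation_triangular_square_le(2)[OF indep[OF a1]], erule m(1), erule m(2), erule m(3), erule m(4), rule a0)
    moreover have "(\<sigma> (a N))\<^sup>2 / a N * (\<Sum>j<a N. (cmod (c N j))\<^sup>2) \<le> (\<sigma> (a N))\<^sup>2 / a N * (L2_norm u)\<^sup>2"
      unfolding c_def by (intro mult_left_mono step_fun_Bessel u) auto
    ultimately show "integrable M (R N)" "expectation (R N) \<le> (\<sigma> (a N))\<^sup>2 / a N * (L2_norm u)\<^sup>2"
      by auto
  qed
  \<comment> \<open>A convergent sequence is bounded. Squaring this bound controls the expectation
    of \<open>R N\<close> times \<open>(k N)^2\<close>, independently of \<open>N\<close>.\<close>
  obtain B where B: "\<bar>k N * \<sigma> (a N) / sqrt (real (a N))\<bar> \<le> B" for N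
    using convergent_imp_Bseq[OF convergentI[OF ratio]] by (auto simp: Bseq_def)
  \<comment> \<open>The sum starts at index \<open>1\<close>, where the assumptions on
    \<open>k\<close> begin; the shift is removed later by \<open>LIMSEQ_imp_Suc\<close>.\<close>
  have "(\<Sum>N. ennreal (expectation (R (Suc N)))) < \<infinity>"
  proof (rule suminf_finite_if_mult_square_bounded[OF _ k_sum])
    fix N
    let ?s = "k (Suc N) * \<sigma> (a (Suc N)) / sqrt (real (a (Suc N)))"
    have "expectation (R (Suc N)) * (k (Suc N))\<^sup>2 \<le> (\<sigma> (a (Suc N)))\<^sup>2 / a (Suc N) * (L2_norm u)\<^sup>2 * (k (Suc N))\<^sup>2"
      by (intro mult_right_mono R_le) auto
    also have "\<dots> = \<bar>?s\<bar>\<^sup>2 * (L2_norm u)\<^sup>2"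
      by (simp add: power_divide power_mult_distrib)
    also have "\<dots> \<le> B\<^sup>2 * (L2_norm u)\<^sup>2"
      by (intro mult_right_mono power_mono B) auto
    finally show "expectation (R (Suc N)) * (k (Suc N))\<^sup>2 \<le> B\<^sup>2 * (L2_norm u)\<^sup>2" .
  qed (simp add: k_nonneg)
  then have "AE \<omega> in M. (\<lambda>N. R (Suc N) \<omega>) \<longlonglongrightarrow> 0"
    by (intro AE_tendsto_0_if_suminf_expectation_finite R_int) (auto simp: R_def intro: sum_nonneg)
  then show ?thesis
    \<comment> \<open>Membership of \<open>\<omega>\<close> in the space is needed for the vanishing
      of the entries above the diagonal. From here on \<open>\<omega>\<close> is fixed and the
      argument is deterministic.\<close>
    using AE_space
  proof eventually_elim
    case (elim \<omega>)
    let ?y = "\<lambda>N. scaled_mat (a N) (\<lambda>i j. X (a N) i j \<omega>) *\<^sub>v W_adj (a N) u"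
    let ?d = "\<lambda>N. L2_norm (\<lambda>x. W (a N) (?y N) x - \<mu>_lim * Volterra u x)"
    let ?b = "\<lambda>N. 2 * R N \<omega> + 2 * ((cmod (\<mu> (a N)) / sqrt (a N) + cmod (\<mu> (a N) - \<mu>_lim)) * L2_norm u)\<^sup>2"
    have d: "(?d N)\<^sup>2 \<le> ?b N" for N
      unfolding R_def
    proof (rule L2_norm_W_minus_Volterra[OF u a0])
      fix i assume "i < a N"
      then show "vec_index (?y N) i = Z N i \<omega> + \<mu> (a N) / of_nat (a N) * (\<Sum>j<Suc i. L2_inner u (step_fun (a N) (Suc j)))"
        unfolding Z_def c_def using upper elim(2) by (intro scaled_mat_mult_W_adj_index) auto
    qed
    have R_lim: "(\<lambda>N. R N \<omega>) \<longlonglongrightarrow> 0"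
      using elim(1) by (rule LIMSEQ_imp_Suc)
    \<comment> \<open>A strictly increasing sequence of naturals is unbounded. Since the means
      converge, the sampling error, of order \<open>cmod (\<mu> (a N)) / sqrt (a N)\<close>, tends
      to zero.\<close>
    have "filterlim (\<lambda>N. sqrt (real (a N))) at_top sequentially"
      using \<open>strict_mono a\<close>
      by (intro filterlim_compose[OF sqrt_at_top] filterlim_compose[OF filterlim_real_sequentially] filterlim_subseq)
    then have "(\<lambda>N. cmod (\<mu> (a N)) / sqrt (a N)) \<longlonglongrightarrow> 0"
      by (intro tendsto_divide_0[OF tendsto_norm[OF mu_lim]] filterlim_at_top_imp_at_infinity)
    moreover have "(\<lambda>N. cmod (\<mu> (a N) - \<mu>_lim)) \<longlonglongrightarrow> 0"
      using mu_lim by (intro tendsto_norm_zero LIM_zero)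
    ultimately have "?b \<longlonglongrightarrow> 2 * 0 + 2 * ((0 + 0) * L2_norm u)\<^sup>2"
      by (intro tendsto_intros R_lim)
    then have "?b \<longlonglongrightarrow> 0" by simp
    then have "(\<lambda>N. (?d N)\<^sup>2) \<longlonglongrightarrow> 0"
      by (rule tendsto_sandwich[OF _ _ tendsto_const, rotated 2]) (simp_all add: d)
    then have "(\<lambda>N. sqrt ((?d N)\<^sup>2)) \<longlonglongrightarrow> sqrt 0"
      by (rule tendsto_real_sqrt)
    then have "?d \<longlonglongrightarrow> 0"
      by (simp add: L2_norm_def integral_unit_leb_nonneg)
    then show ?case
      unfolding L2_tendsto_def using W_in_L2 Volterra_mult_in_L2[OF u] by blast
  qed
qed

end
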